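(* Let $\epsilon>0$, let $x_0\in\mathbb{R}^d$, let $B(\epsilon)=\{\delta\in\mathbb{R}^d:\|\delta\|_2\le\epsilon\}$, and let $\ell$ be a real-valued function that is twice continuously differentiable on an open neighbourhood of $x_0+B(\epsilon)$, with Hessian $\nabla_x^2\ell(x_0+\delta)$ positive definite for all $\delta\in B(\epsilon)$. Assume $\nabla_x\ell(x_0)\neq 0$. For $\delta\in B(\epsilon)$ with $\nabla_x\ell(x_0+\delta)\neq 0$ set $$F(\delta)=\epsilon\,\frac{\nabla_x\ell(x_0+\delta)}{\|\nabla_x\ell(x_0+\delta)\|_2}.$$ Then: (i) An optimal perturbation $\delta^\star$, i.e. a maximizer of $\delta\mapsto\ell(x_0+\delta)$ over $B(\epsilon)$, exists and solves the fixed-point problem $\delta^\star=F(\delta^\star)$. (ii) $F$ is Lipschitz around the origin with constant $K=2\epsilon\,\|\nabla_x^2\ell\|/\|\nabla_x\ell(x_0)\|_2$, that is, $$\|F(\delta)-F(0)\|_2\le K\|\delta\|_2$$ for all $\delta\in B(\epsilon)$ at which $F$ is defined. (iii) If $K<1$, the fixed-point problem converges: the iteration $\delta^{(0)}=0$, $\delta^{(k+1)}=F(\delta^{(k)})$ converges to $\delta^\star$.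
   Context: $\nabla_x\ell$ and $\nabla_x^2\ell$ denote the gradient and Hessian of the loss $\ell$ with respect to its input in $\mathbb{R}^d$. $\|\nabla_x^2\ell\|$ denotes $\sup_{\delta\in B(\epsilon)}\|\nabla_x^2\ell(x_0+\delta)\|_{\mathrm{op}}$, where $\|\cdot\|_{\mathrm{op}}$ is the operator norm induced by the Euclidean norm. *)

theory Defs
  imports "HOL-Analysis.Analysis"
begin

definition gradient :: "('a::real_inner \<Rightarrow> real) \<Rightarrow> 'a \<Rightarrow> 'a" where
  "gradient f x = (THE g. GDERIV f x :> g)"

definition hessian :: "(real ^ 'n \<Rightarrow> real) \<Rightarrow> real ^ 'n \<Rightarrow> real ^ 'n ^ 'n" where
  "hessian f x = matrix (frechet_derivative (gradient f) (at x))"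

text \<open>Intended for open sets U, since all derivatives are two-sided. Both differentiability
  conditions are needed: gradient and hessian are total functions, unspecified where the
  derivative does not exist.\<close>

definition twice_cont_diff_on :: "(real ^ 'n \<Rightarrow> real) \<Rightarrow> (real ^ 'n) set \<Rightarrow> bool" where
  "twice_cont_diff_on f U \<longleftrightarrow>
     (\<forall>x\<in>U. f differentiable (at x)) \<and>
     (\<forall>x\<in>U. gradient f differentiable (at x)) \<and>
     continuous_on U (hessian f)"

definition positive_definite :: "real ^ 'n ^ 'n \<Rightarrow> bool" where
  "positive_definite A \<longleftrightarrow> transpose A = A \<and> (\<forall>v. v \<noteq> 0 \<longrightarrow> v \<bullet> (A *v v) > 0)"

text \<open>The supremum is that of a bounded set whenever f is twice continuously differentiable
  near the closed ball around x of radius e, because that ball is compact.\<close>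

definition hessian_sup_norm :: "(real ^ 'n \<Rightarrow> real) \<Rightarrow> real ^ 'n \<Rightarrow> real \<Rightarrow> real" where
  "hessian_sup_norm f x e = (SUP \<delta>\<in>cball 0 e. onorm ((*v) (hessian f (x + \<delta>))))"

text \<open>The map F. It is meaningful only where the gradient at the point x + d is nonzero;
  elsewhere the formula returns 0 by the convention for division by zero, so statements about it
  have to carry the nonvanishing of the gradient explicitly.\<close>

definition perturbation_map ::
  "(real ^ 'n \<Rightarrow> real) \<Rightarrow> real ^ 'n \<Rightarrow> real \<Rightarrow> real ^ 'n \<Rightarrow> real ^ 'n" where
  "perturbation_map f x e d = e *\<^sub>R (gradient f (x + d) /\<^sub>R norm (gradient f (x + d)))"

definition lipschitz_const :: "(real ^ 'n \<Rightarrow> real) \<Rightarrow> real ^ 'n \<Rightarrow> real \<Rightarrow> real" where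
  "lipschitz_const f x e = 2 * e * hessian_sup_norm f x e / norm (gradient f x)"

definition optimal_perturbation ::
  "(real ^ 'n \<Rightarrow> real) \<Rightarrow> real ^ 'n \<Rightarrow> real \<Rightarrow> real ^ 'n \<Rightarrow> bool" where
  "optimal_perturbation f x e d \<longleftrightarrow> is_arg_max (\<lambda>\<delta>. f (x + \<delta>)) (\<lambda>\<delta>. \<delta> \<in> cball 0 e) d"

end

theory Submission
  imports Defs
begin

text \<open>At a maximizer d over the ball of radius e, first-order optimality reads
  g \<bullet> (y - d) \<le> 0 for every y in the ball, where g is the gradient at d. If g vanished,
  strict convexity would make d a strict minimizer; hence g is nonzero, and y = e g / |g| forces
  equality in Cauchy-Schwarz, that is d = e g / |g|.

  For the convergence, the bound K < 1 means L e < |g(0)| / 2, where L is the supremum of the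
  Hessian norm. The gradient therefore has norm at least m = |g(0)| - L e > L e on the whole ball.
  Since normalization is (1/m)-Lipschitz on vectors of norm at least m, F contracts distances
  between arbitrary points of the ball by the factor L e / m < 1, whereas the estimate in (ii)
  controls only distances from the origin.\<close>

section \<open>Lipschitz estimates for normalization of vectors\<close>

lemma norm_normalize_diff_le:
  fixes u v :: "'a::real_inner"
  assumes "m > 0" "m \<le> norm u" "m \<le> norm v"
  shows "norm (u /\<^sub>R norm u - v /\<^sub>R norm v) \<le> norm (u - v) / m"
proof -
  let ?w = "u /\<^sub>R norm u - v /\<^sub>R norm v"
  have pos: "norm u > 0" "norm v > 0"
    using assms by linarith+
  \<comment> \<open>The proof rests on the identity |u| |v| |w|^2 = |u - v|^2 - (|u| - |v|)^2.
    Dropping the last square gives the constant 1/m without a factor 2. This matters for the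
    contraction: with that factor, it would require 3 L e < |g(0)|, whereas K < 1 gives only 2 L e <
    |g(0)|.\<close>
  have "(norm ?w)\<^sup>2 = 2 - 2 * (u \<bullet> v) / (norm u * norm v)"
    using pos dot_norm_neg[of "u /\<^sub>R norm u" "v /\<^sub>R norm v"] by (simp add: field_simps)
  then have "norm u * norm v * (norm ?w)\<^sup>2 = 2 * norm u * norm v - 2 * (u \<bullet> v)"
    using pos by (simp add: field_simps)
  also have "\<dots> = (norm (u - v))\<^sup>2 - (norm u - norm v)\<^sup>2"
    by (simp add: dot_norm_neg power2_diff field_simps)
  also have "\<dots> \<le> (norm (u - v))\<^sup>2"
    by simp
  finally have "norm u * norm v * (norm ?w)\<^sup>2 \<le> (norm (u - v))\<^sup>2" .
  moreover have "m * m * (norm ?w)\<^sup>2 \<le> norm u * norm v * (norm ?w)\<^sup>2"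
    using assms by (intro mult_right_mono mult_mono) auto
  ultimately have "(m * norm ?w)\<^sup>2 \<le> (norm (u - v))\<^sup>2"
    by (simp add: power_mult_distrib power2_eq_square[of m])
  then have "m * norm ?w \<le> norm (u - v)"
    by (rule power2_le_imp_le) simp
  then show ?thesis
    using \<open>m > 0\<close> by (simp add: field_simps)
qed

text \<open>Rescaling by |v| splits the difference into a change of length and \<open>u - v\<close>,
  each of norm at most |u - v|. The bound involves only the norm of \<open>v\<close>. This suits
  claim (ii), where \<open>v\<close> is the gradient at the centre and \<open>u\<close> may be
  arbitrarily short because K < 1 is not assumed.\<close>

lemma norm_normalize_diff_le_twice:
  fixes u v :: "'a::real_normed_vector"
  assumes "u \<noteq> 0" "v \<noteq> 0"
  shows "norm (u /\<^sub>R norm u - v /\<^sub>R norm v) \<le> 2 * norm (u - v) / norm v"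
proof -
  let ?w = "u /\<^sub>R norm u - v /\<^sub>R norm v"
  have "norm v *\<^sub>R ?w = (norm v - norm u) *\<^sub>R (u /\<^sub>R norm u) + (u - v)"
    using assms by (simp add: algebra_simps)
  then have "norm v * norm ?w = norm ((norm v - norm u) *\<^sub>R (u /\<^sub>R norm u) + (u - v))"
    by (metis abs_norm_cancel norm_scaleR)
  also have "\<dots> \<le> \<bar>norm v - norm u\<bar> + norm (u - v)"
    using assms by (intro order_trans[OF norm_triangle_ineq]) (simp add: abs_mult mult.assoc)
  also have "\<dots> \<le> 2 * norm (u - v)"
    using norm_triangle_ineq3[of v u] by (simp add: norm_minus_commute)
  finally show ?thesis
    using assms by (simp add: field_simps)
qed

section \<open>First- and second-order conditions for extrema on convex sets\<close>

lemma has_derivative_maximum_on_convex: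
  fixes f :: "'a::real_normed_vector \<Rightarrow> real"
  assumes "convex S" "a \<in> S" "y \<in> S" and f: "(f has_derivative f') (at a)"
    and max: "\<And>x. x \<in> S \<Longrightarrow> f x \<le> f a"
  shows "f' (y - a) \<le> 0"
proof (rule ccontr)
  assume "\<not> f' (y - a) \<le> 0"
  moreover have "((\<lambda>t. f (a + t *\<^sub>R (y - a))) has_derivative (\<lambda>t. f' (t *\<^sub>R (y - a)))) (at 0)"
    by (rule has_derivative_compose[where g = f, THEN has_derivative_eq_rhs])
      (auto intro!: derivative_eq_intros f)
  then have "((\<lambda>t. f (a + t *\<^sub>R (y - a))) has_real_derivative f' (y - a)) (at 0)"
    using has_derivative_linear[OF f]
    by (simp add: has_field_derivative_def linear_cmul mult.commute[of _ "f' _"])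
  ultimately obtain e where "e > 0"
    and inc: "\<And>h. h > 0 \<Longrightarrow> h < e \<Longrightarrow> f (a + 0 *\<^sub>R (y - a)) < f (a + (0 + h) *\<^sub>R (y - a))"
    using DERIV_pos_inc_right[of "\<lambda>t. f (a + t *\<^sub>R (y - a))"] by (metis not_le)
  \<comment> \<open>The step must lie strictly below \<open>e\<close>, where the increase is
    guaranteed, and must not exceed 1, so that the point stays on the segment from \<open>a\<close>
    to \<open>y\<close>.\<close>
  define h where "h = min (e / 2) 1"
  have h: "h > 0" "h < e" "h \<le> 1"
    using \<open>e > 0\<close> by (auto simp: h_def)
  have "(1 - h) *\<^sub>R a + h *\<^sub>R y \<in> S"
    using assms h by (intro convexD) auto
  then have "a + h *\<^sub>R (y - a) \<in> S"
    by (simp add: algebra_simps)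
  with max inc[OF h(1,2)] show False
    by fastforce
qed

text \<open>Along the segment from \<open>d\<close> to \<open>a\<close> the slope of
  \<open>f\<close> starts at 0 and has positive derivative, so it is positive beyond the start and
  \<open>f\<close> increases strictly.\<close>

lemma critical_point_strict_minimum:
  fixes f :: "'a::real_inner \<Rightarrow> real"
  assumes "convex S" "d \<in> S" "a \<in> S" "a \<noteq> d" "g d = 0"
    and f: "\<And>x. x \<in> S \<Longrightarrow> (f has_derivative (\<lambda>h. h \<bullet> g x)) (at x)"
    and g: "\<And>x. x \<in> S \<Longrightarrow> (g has_derivative g' x) (at x)"
    and pos: "\<And>x v. x \<in> S \<Longrightarrow> v \<noteq> 0 \<Longrightarrow> v \<bullet> g' x v > 0"
  shows "f d < f a"
proof -
  define p where "p t = d + t *\<^sub>R (a - d)" for t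
  have p: "p t \<in> S" if "0 \<le> t" "t \<le> 1" for t
  proof -
    have "(1 - t) *\<^sub>R d + t *\<^sub>R a \<in> S"
      using assms that by (intro convexD) auto
    then show ?thesis
      by (simp add: p_def algebra_simps)
  qed
  have dp: "(p has_derivative (\<lambda>t. t *\<^sub>R (a - d))) (at t)" for t
    unfolding p_def by (auto intro!: derivative_eq_intros)
  have d1: "((\<lambda>t. f (p t)) has_real_derivative (a - d) \<bullet> g (p t)) (at t)"
    if "0 \<le> t" "t \<le> 1" for t
    using has_derivative_compose[OF dp f[OF p[OF that]]]
    by (simp add: has_field_derivative_def mult.commute[of _ "_ \<bullet> _"])
  have d2: "((\<lambda>t. (a - d) \<bullet> g (p t)) has_real_derivative (a - d) \<bullet> g' (p t) (a - d)) (at t)"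
    if "0 \<le> t" "t \<le> 1" for t
    using has_derivative_inner_right[OF has_derivative_compose[OF dp g[OF p[OF that]]], of "a - d"]
      has_derivative_linear[OF g[OF p[OF that]]]
    by (simp add: has_field_derivative_def linear_cmul mult.commute[of _ "_ \<bullet> _"])
  have slope: "(a - d) \<bullet> g (p t) > 0" if "0 < t" "t \<le> 1" for t
  proof -
    have "(a - d) \<bullet> g (p 0) < (a - d) \<bullet> g (p t)"
      using that assms(4) d2 p pos
      by (intro DERIV_pos_imp_increasing[OF \<open>0 < t\<close>]) (metis order_trans right_minus_eq)
    then show ?thesis
      using \<open>g d = 0\<close> by (simp add: p_def)
  qed
  \<comment> \<open>The slope vanishes at parameter 0, so monotonicity is derived from positivity on
    the open interval together with continuity at the endpoints.\<close>
  have "f (p 0) < f (p 1)"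
  proof (rule DERIV_pos_imp_increasing_open[where f = "\<lambda>t. f (p t)"])
    show "continuous_on {0..1} (\<lambda>t. f (p t))"
      by (rule DERIV_atLeastAtMost_imp_continuous_on) (use d1 in blast)
  qed (use d1 slope in \<open>auto intro: less_imp_le\<close>)
  then show ?thesis
    by (simp add: p_def)
qed

lemma maximum_on_ball_eq_scaled_gradient:
  fixes f :: "'a::real_inner \<Rightarrow> real"
  assumes "e > 0" "norm d \<le> e" "g \<noteq> 0"
    and f: "(f has_derivative (\<lambda>h. h \<bullet> g)) (at d)"
    and max: "\<And>x. norm x \<le> e \<Longrightarrow> f x \<le> f d"
  shows "d = e *\<^sub>R (g /\<^sub>R norm g)"
proof -
  define y where "y = e *\<^sub>R (g /\<^sub>R norm g)"
  have y: "norm y = e"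
    using assms by (simp add: y_def)
  have "(y - d) \<bullet> g \<le> 0"
    by (rule has_derivative_maximum_on_convex[OF _ _ _ f, of "cball 0 e"])
      (use assms y in auto)
  moreover have "y \<bullet> g = e * norm g"
    using \<open>g \<noteq> 0\<close> by (simp add: y_def power2_norm_eq_inner[symmetric] power2_eq_square)
  ultimately have "e * norm g \<le> d \<bullet> g"
    by (simp add: inner_diff_left)
  moreover have "d \<bullet> g \<le> norm d * norm g"
    by (rule norm_cauchy_schwarz)
  moreover have "norm d * norm g \<le> e * norm g"
    using assms by (intro mult_right_mono) auto
  \<comment> \<open>The chain e |g| \<le> d \<bullet> g \<le> |d| |g| \<le> e |g| collapses. The
    first equality makes \<open>d\<close> a nonnegative multiple of \<open>g\<close>, the second
    puts it on the sphere.\<close>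
  ultimately have *: "d \<bullet> g = norm d * norm g" and "norm d * norm g = e * norm g"
    by linarith+
  then have "norm d = e"
    using \<open>g \<noteq> 0\<close> by simp
  have "norm g *\<^sub>R d = norm d *\<^sub>R g"
    using * norm_cauchy_schwarz_eq[of d g] by simp
  then have "norm g *\<^sub>R d = norm g *\<^sub>R y"
    using \<open>g \<noteq> 0\<close> \<open>norm d = e\<close> by (simp add: y_def)
  then show ?thesis
    using \<open>g \<noteq> 0\<close> unfolding y_def[symmetric] by simp
qed

section \<open>Gradient and Hessian as derivatives, and the supremum of the Hessian norm\<close>

lemma has_derivative_gradient:
  fixes f :: "'a::euclidean_space \<Rightarrow> real"
  assumes "f differentiable (at x)"
  shows "(f has_derivative (\<lambda>h. h \<bullet> gradient f x)) (at x)"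
proof -
  obtain f' where f': "(f has_derivative f') (at x)"
    using assms by (auto simp: differentiable_def)
  \<comment> \<open>The Riesz representative of the functional \<open>f'\<close> is its adjoint
    applied to the real number 1.\<close>
  have "GDERIV f x :> adjoint f' 1"
    using f' adjoint_works[OF has_derivative_linear[OF f'], of _ 1] by (simp add: gderiv_def)
  moreover have "g = g'" if "GDERIV f x :> g" "GDERIV f x :> g'" for g g'
    using has_derivative_unique[OF that[unfolded gderiv_def]]
    by (metis vector_eq_ldot)
  ultimately have "GDERIV f x :> gradient f x"
    unfolding gradient_def by (metis theI)
  then show ?thesis
    by (simp add: gderiv_def)
qed

lemma has_derivative_hessian:
  assumes "gradient f differentiable (at x)"
  shows "(gradient f has_derivative (*v) (hessian f x)) (at x)"
proof -
  have *: "(gradient f has_derivative frechet_derivative (gradient f) (at x)) (at x)"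
    using assms frechet_derivative_works by blast
  have "(*v) (hessian f x) = frechet_derivative (gradient f) (at x)"
    using matrix_works[of "frechet_derivative (gradient f) (at x)"] has_derivative_linear[OF *]
    by (auto simp: hessian_def linear_matrix_vector_mul_eq)
  with * show ?thesis
    by simp
qed

text \<open>A supremum of reals is known to dominate its members only if they are bounded above.
  Compactness of the ball bounds the Hessian, hence its entries uniformly, and these bound the
  operator norm.\<close>

lemma onorm_le_hessian_sup_norm:
  assumes cont: "continuous_on ((+) x ` cball 0 e) (hessian f)" and d: "d \<in> cball 0 e"
  shows "onorm ((*v) (hessian f (x + d))) \<le> hessian_sup_norm f x e"
  unfolding hessian_sup_norm_def
proof (rule cSUP_upper[OF d])
  have "bounded (hessian f ` ((+) x ` cball 0 e))"
    by (intro compact_imp_bounded compact_continuous_image cont compact_translation compact_cball)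
  then obtain B where B: "\<And>d. d \<in> cball 0 e \<Longrightarrow> norm (hessian f (x + d)) \<le> B"
    unfolding bounded_iff by blast
  have "\<bar>hessian f (x + d) $ i $ j\<bar> \<le> B" if "d \<in> cball 0 e" for d i j
    using B[OF that] component_le_norm_cart[of "hessian f (x + d) $ i" j]
      Finite_Cartesian_Product.norm_nth_le[of "hessian f (x + d)" i] by linarith
  then show "bdd_above ((\<lambda>\<delta>. onorm ((*v) (hessian f (x + \<delta>)))) ` cball 0 e)"
    by (intro bdd_aboveI2[OF onorm_le_matrix_component])
qed

section \<open>Iteration of a contraction, and its application to the perturbation map\<close>

lemma funpow_tendsto_fixed_point:
  fixes F :: "'a::real_normed_vector \<Rightarrow> 'a"
  assumes "0 \<le> c" "c < 1" "F d = d" "d \<in> S" "a \<in> S"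
    and S: "\<And>x. x \<in> S \<Longrightarrow> F x \<in> S"
    and F: "\<And>x y. x \<in> S \<Longrightarrow> y \<in> S \<Longrightarrow> norm (F x - F y) \<le> c * norm (x - y)"
  shows "(\<lambda>k. (F ^^ k) a) \<longlonglongrightarrow> d"
proof -
  have inS: "(F ^^ k) a \<in> S" for k
    by (induction k) (auto simp: assms)
  \<comment> \<open>As the fixed point is given, geometric decay of the distance to it suffices;
    neither completeness nor closedness of \<open>S\<close> enters.\<close>
  have bound: "norm ((F ^^ k) a - d) \<le> c ^ k * norm (a - d)" for k
  proof (induction k)
    case (Suc k)
    have "norm ((F ^^ Suc k) a - d) \<le> c * norm ((F ^^ k) a - d)"
      using F[OF inS[of k] \<open>d \<in> S\<close>] \<open>F d = d\<close> by simp
    also have "\<dots> \<le> c * (c ^ k * norm (a - d))"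
      using Suc \<open>0 \<le> c\<close> by (rule mult_left_mono)
    finally show ?case
      by (simp add: mult.assoc)
  qed simp
  have "(\<lambda>k. c ^ k * norm (a - d)) \<longlonglongrightarrow> 0"
    using assms(1,2) by (intro tendsto_mult_left_zero LIMSEQ_power_zero) auto
  then have "(\<lambda>k. (F ^^ k) a - d) \<longlonglongrightarrow> 0"
    by (rule Lim_null_comparison[rotated]) (simp add: bound)
  then show ?thesis
    by (rule LIM_zero_cancel)
qed

text \<open>Since \<open>perturbation_map\<close> returns 0 where the gradient vanishes, the
  fixed-point and convergence claims also assert that the gradient is nonzero at the maximizer and
  at every iterate. Convergence to every maximizer makes the maximizer unique when K < 1.\<close>

theorem proposition1:
  fixes l :: "real ^ 'n \<Rightarrow> real" and x\<^sub>0 :: "real ^ 'n" and \<epsilon> :: real and U :: "(real ^ 'n) set"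
  assumes "\<epsilon> > 0"
    and "open U"
    and "(+) x\<^sub>0 ` cball 0 \<epsilon> \<subseteq> U"
    and "twice_cont_diff_on l U"
    and "\<forall>\<delta>\<in>cball 0 \<epsilon>. positive_definite (hessian l (x\<^sub>0 + \<delta>))"
    and "gradient l x\<^sub>0 \<noteq> 0"
  shows "((\<exists>\<delta>. optimal_perturbation l x\<^sub>0 \<epsilon> \<delta>) \<and>
          (\<forall>\<delta>. optimal_perturbation l x\<^sub>0 \<epsilon> \<delta> \<longrightarrow>
             gradient l (x\<^sub>0 + \<delta>) \<noteq> 0 \<and> \<delta> = perturbation_map l x\<^sub>0 \<epsilon> \<delta>)) \<and>
         (\<forall>\<delta>\<in>cball 0 \<epsilon>. gradient l (x\<^sub>0 + \<delta>) \<noteq> 0 \<longrightarrow>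
             norm (perturbation_map l x\<^sub>0 \<epsilon> \<delta> - perturbation_map l x\<^sub>0 \<epsilon> 0)
               \<le> lipschitz_const l x\<^sub>0 \<epsilon> * norm \<delta>) \<and>
         (lipschitz_const l x\<^sub>0 \<epsilon> < 1 \<longrightarrow>
            (\<forall>k. (perturbation_map l x\<^sub>0 \<epsilon> ^^ k) 0 \<in> cball 0 \<epsilon> \<and>
                 gradient l (x\<^sub>0 + (perturbation_map l x\<^sub>0 \<epsilon> ^^ k) 0) \<noteq> 0) \<and>
            (\<forall>\<delta>. optimal_perturbation l x\<^sub>0 \<epsilon> \<delta> \<longrightarrow>
               (\<lambda>k. (perturbation_map l x\<^sub>0 \<epsilon> ^^ k) 0) \<longlonglongrightarrow> \<delta>))"
proof -
  define f where "f = (\<lambda>\<delta>. l (x\<^sub>0 + \<delta>))"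
  define G where "G \<delta> = gradient l (x\<^sub>0 + \<delta>)" for \<delta>
  define H where "H \<delta> = hessian l (x\<^sub>0 + \<delta>)" for \<delta>
  define F where "F = perturbation_map l x\<^sub>0 \<epsilon>"
  define L where "L = hessian_sup_norm l x\<^sub>0 \<epsilon>"
  define B where "B = cball (0 :: real ^ 'n) \<epsilon>"
  have inU: "x\<^sub>0 + \<delta> \<in> U" if "\<delta> \<in> B" for \<delta>
    using assms(3) that unfolding B_def by blast
  have zero: "0 \<in> B" and "convex B"
    using \<open>\<epsilon> > 0\<close> by (auto simp: B_def)
  have shift: "((+) x\<^sub>0 has_derivative (\<lambda>h. h)) (at \<delta>)" for \<delta>
    by (auto intro!: derivative_eq_intros)
  have f: "(f has_derivative (\<lambda>h. h \<bullet> G \<delta>)) (at \<delta>)" if "\<delta> \<in> B" for \<delta>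
    using has_derivative_compose[OF shift has_derivative_gradient[of l]] inU[OF that] assms(4)
    by (simp add: twice_cont_diff_on_def f_def G_def)
  have G: "(G has_derivative (*v) (H \<delta>)) (at \<delta>)" if "\<delta> \<in> B" for \<delta>
    using has_derivative_compose[OF shift has_derivative_hessian[of l]] inU[OF that] assms(4)
    by (simp add: twice_cont_diff_on_def G_def[abs_def] H_def)
  have H_pos: "v \<bullet> (H \<delta> *v v) > 0" if "\<delta> \<in> B" "v \<noteq> 0" for \<delta> v
    using assms(5) that by (auto simp: positive_definite_def H_def B_def)
  have H_le: "onorm ((*v) (H \<delta>)) \<le> L" if "\<delta> \<in> B" for \<delta>
    unfolding H_def L_def
    by (rule onorm_le_hessian_sup_norm)
      (use assms(3,4) that in \<open>auto simp: twice_cont_diff_on_def B_def intro: continuous_on_subset\<close>)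
  have "0 \<le> L"
    using H_le[OF zero] onorm_pos_le[OF matrix_vector_mul_bounded_linear] order_trans by blast
  have G_lip: "norm (G a - G b) \<le> L * norm (a - b)" if "a \<in> B" "b \<in> B" for a b
    using \<open>convex B\<close> has_derivative_at_withinI[OF G] H_le that by (rule differentiable_bound)
  have F_eq: "F \<delta> = \<epsilon> *\<^sub>R (G \<delta> /\<^sub>R norm (G \<delta>))" for \<delta>
    by (simp add: F_def perturbation_map_def G_def)
  have F_diff: "norm (F a - F b) = \<epsilon> * norm (G a /\<^sub>R norm (G a) - G b /\<^sub>R norm (G b))" for a b
    using \<open>\<epsilon> > 0\<close> unfolding F_eq scaleR_diff_right[symmetric] norm_scaleR by simp
  \<comment> \<open>This holds for every argument: the value has norm \<open>\<epsilon>\<close>, or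
    is 0 by default where the gradient vanishes.\<close>
  have F_in: "F \<delta> \<in> B" for \<delta>
    using \<open>\<epsilon> > 0\<close> by (cases "G \<delta> = 0") (auto simp: F_eq B_def)
  have G0: "G 0 \<noteq> 0"
    using assms(6) by (simp add: G_def)
  have K: "lipschitz_const l x\<^sub>0 \<epsilon> = 2 * \<epsilon> * L / norm (G 0)"
    by (simp add: lipschitz_const_def L_def G_def)
  have opt: "optimal_perturbation l x\<^sub>0 \<epsilon> d \<longleftrightarrow> d \<in> B \<and> (\<forall>\<delta>\<in>B. f \<delta> \<le> f d)" for d
    by (auto simp: optimal_perturbation_def is_arg_max_linorder f_def B_def)
  have "continuous_on B f"
    using f has_derivative_continuous continuous_at_imp_continuous_on by blast
  then have ex: "\<exists>d. optimal_perturbation l x\<^sub>0 \<epsilon> d"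
    using continuous_attains_sup[of B f] zero unfolding opt by (auto simp: B_def)
  have fixpoint: "G d \<noteq> 0 \<and> d = F d" if d: "optimal_perturbation l x\<^sub>0 \<epsilon> d" for d
  proof -
    have dB: "d \<in> B" and max: "\<And>\<delta>. \<delta> \<in> B \<Longrightarrow> f \<delta> \<le> f d"
      using d by (auto simp: opt)
    have Gd: "G d \<noteq> 0"
    proof
      assume "G d = 0"
      \<comment> \<open>The centre is a legitimate comparison point: its gradient is nonzero, so it
        differs from \<open>d\<close>.\<close>
      then have "f d < f 0"
        using critical_point_strict_minimum[OF \<open>convex B\<close> dB zero _ _ f G H_pos] G0 by auto
      with max[OF zero] show False
        by simp
    qed
    moreover have "d = F d"
      unfolding F_eq
      by (rule maximum_on_ball_eq_scaled_gradient[OF \<open>\<epsilon> > 0\<close> _ Gd f[OF dB]])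
        (use dB max in \<open>auto simp: B_def\<close>)
    ultimately show ?thesis
      by blast
  qed
  have lip: "norm (F \<delta> - F 0) \<le> lipschitz_const l x\<^sub>0 \<epsilon> * norm \<delta>"
    if "\<delta> \<in> B" "G \<delta> \<noteq> 0" for \<delta>
  proof -
    have "norm (F \<delta> - F 0) \<le> \<epsilon> * (2 * norm (G \<delta> - G 0) / norm (G 0))"
      unfolding F_diff
      using \<open>\<epsilon> > 0\<close> that G0 by (intro mult_left_mono norm_normalize_diff_le_twice) auto
    also have "\<dots> \<le> \<epsilon> * (2 * (L * norm \<delta>) / norm (G 0))"
      using G_lip[OF that(1) zero] \<open>\<epsilon> > 0\<close>
      by (intro mult_left_mono divide_right_mono) auto
    finally show ?thesis
      by (simp add: K mult_ac)
  qed
  have conv: "(F ^^ k) 0 \<in> B \<and> G ((F ^^ k) 0) \<noteq> 0"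
      "optimal_perturbation l x\<^sub>0 \<epsilon> d \<Longrightarrow> (\<lambda>k. (F ^^ k) 0) \<longlonglongrightarrow> d"
    if "lipschitz_const l x\<^sub>0 \<epsilon> < 1" for k d
  proof -
    define m where "m = norm (G 0) - L * \<epsilon>"
    have "L * \<epsilon> < m"
      using that G0 by (simp add: K m_def field_simps)
    moreover have "0 \<le> L * \<epsilon>"
      using \<open>0 \<le> L\<close> \<open>\<epsilon> > 0\<close> by simp
    ultimately have "m > 0"
      by linarith
    have m: "m \<le> norm (G \<delta>)" if "\<delta> \<in> B" for \<delta>
    proof -
      have "norm (G 0) - norm (G \<delta>) \<le> norm (G \<delta> - G 0)"
        by (metis norm_minus_commute norm_triangle_ineq2)
      also have "\<dots> \<le> L * norm (\<delta> - 0)"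
        using that zero by (rule G_lip)
      also have "\<dots> \<le> L * \<epsilon>"
        using that \<open>0 \<le> L\<close> by (intro mult_left_mono) (auto simp: B_def)
      finally show ?thesis
        by (simp add: m_def)
    qed
    have contr: "norm (F a - F b) \<le> L * \<epsilon> / m * norm (a - b)" if "a \<in> B" "b \<in> B" for a b
    proof -
      have "norm (F a - F b) \<le> \<epsilon> * (norm (G a - G b) / m)"
        unfolding F_diff using \<open>\<epsilon> > 0\<close> \<open>m > 0\<close> m that
        by (intro mult_left_mono norm_normalize_diff_le) auto
      also have "\<dots> \<le> \<epsilon> * (L * norm (a - b) / m)"
        using G_lip[OF that] \<open>\<epsilon> > 0\<close> \<open>m > 0\<close> by (intro mult_left_mono divide_right_mono) auto
      finally show ?thesis
        by (simp add: mult_ac)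
    qed
    have inB: "(F ^^ k) 0 \<in> B"
      by (cases k) (auto simp: zero F_in)
    with m \<open>m > 0\<close> show "(F ^^ k) 0 \<in> B \<and> G ((F ^^ k) 0) \<noteq> 0"
      by fastforce
    show "(\<lambda>k. (F ^^ k) 0) \<longlonglongrightarrow> d" if "optimal_perturbation l x\<^sub>0 \<epsilon> d"
    proof (rule funpow_tendsto_fixed_point[where S = B and c = "L * \<epsilon> / m"])
      show "F d = d"
        using fixpoint[OF that] by simp
    qed (use that \<open>m > 0\<close> \<open>0 \<le> L * \<epsilon>\<close> \<open>L * \<epsilon> < m\<close> zero F_in contr in \<open>auto simp: opt\<close>)
  qed
  show ?thesis
    using ex fixpoint lip conv unfolding F_def G_def B_def by blast
qed

end
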